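(* Let $n\ge 3$ and $1\le t\le \frac n2$ be integers. The generalized Petersen graph $P(n,t)$ is $(1,3)$-choosable.
   Context: The generalized Petersen graph $P(n,t)$ is the simple graph with vertex set $\{u_i,v_i:1\le i\le n\}$ and edge set $\{u_iu_{i+1},\,u_iv_i,\,v_iv_{i+t}: 1\le i\le n\}$, indices taken modulo $n$. A total weighting of a graph $G$ is a map $\phi:V(G)\cup E(G)\to\mathbb{R}$; the vertex-sum of $v$ is $S_\phi(v)=\phi(v)+\sum_{e\in E(v)}\phi(e)$, where $E(v)$ is the set of edges incident to $v$. It is proper if $S_\phi(u)\ne S_\phi(v)$ for every edge $uv$. A graph $G$ is $(k,k')$-choosable if for every assignment $L$ giving each vertex $x$ a set $L(x)$ of $k$ real numbers and each edge $e$ a set $L(e)$ of $k'$ real numbers, there is a proper total weighting $\phi$ with $\phi(y)\in L(y)$ for all $y\in V(G)\cup E(G)$. *)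

theory Defs
  imports Complex_Main
begin

text \<open>A graph is a pair of a vertex set and an edge set, the edges being two-element sets of
  vertices.\<close>

type_synonym 'a graph = "'a set \<times> 'a set set"

abbreviation verts :: "'a graph \<Rightarrow> 'a set" where
  "verts G \<equiv> fst G"

abbreviation edges :: "'a graph \<Rightarrow> 'a set set" where
  "edges G \<equiv> snd G"

definition finite_simple_graph :: "'a graph \<Rightarrow> bool" where
  "finite_simple_graph G \<longleftrightarrow> finite (verts G) \<and> (\<forall>e\<in>edges G. e \<subseteq> verts G \<and> card e = 2)"

definition incident_edges :: "'a graph \<Rightarrow> 'a \<Rightarrow> 'a set set" where
  "incident_edges G v = {e \<in> edges G. v \<in> e}"

text \<open>A total weighting is given by its restriction \<open>\<phi>\<close> to the vertices and its restriction
  \<open>\<psi>\<close> to the edges; values outside the graph are irrelevant. List assignments are split in the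
  same way.\<close>

definition vertex_sum :: "'a graph \<Rightarrow> ('a \<Rightarrow> real) \<Rightarrow> ('a set \<Rightarrow> real) \<Rightarrow> 'a \<Rightarrow> real" where
  "vertex_sum G \<phi> \<psi> v = \<phi> v + (\<Sum>e\<in>incident_edges G v. \<psi> e)"

definition proper_total_weighting :: "'a graph \<Rightarrow> ('a \<Rightarrow> real) \<Rightarrow> ('a set \<Rightarrow> real) \<Rightarrow> bool" where
  "proper_total_weighting G \<phi> \<psi> \<longleftrightarrow>
     (\<forall>u v. {u, v} \<in> edges G \<longrightarrow> vertex_sum G \<phi> \<psi> u \<noteq> vertex_sum G \<phi> \<psi> v)"

definition choosable :: "nat \<Rightarrow> nat \<Rightarrow> 'a graph \<Rightarrow> bool" where
  "choosable k k' G \<longleftrightarrow>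
     (\<forall>(L :: 'a \<Rightarrow> real set) (M :: 'a set \<Rightarrow> real set).
        (\<forall>x\<in>verts G. finite (L x) \<and> card (L x) = k) \<and>
        (\<forall>e\<in>edges G. finite (M e) \<and> card (M e) = k') \<longrightarrow>
        (\<exists>\<phi> \<psi>. (\<forall>x\<in>verts G. \<phi> x \<in> L x) \<and> (\<forall>e\<in>edges G. \<psi> e \<in> M e) \<and>
               proper_total_weighting G \<phi> \<psi>))"

text \<open>Indices modulo \<open>n\<close> are represented by \<open>0, \<dots>, n - 1\<close>. For \<open>n = 2 * t\<close> the two descriptions
  of an inner edge, from \<open>i\<close> and from \<open>i + t\<close>, denote the same edge, so that the inner vertices
  then have degree 2.\<close>

datatype petersen_vertex = U nat | V nat

definition petersen :: "nat \<Rightarrow> nat \<Rightarrow> petersen_vertex graph" where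
  "petersen n t =
     (U ` {..<n} \<union> V ` {..<n},
      (\<Union>i<n. {{U i, U ((i + 1) mod n)}, {U i, V i}, {V i, V ((i + t) mod n)}}))"

lemma add_mod_neq:
  fixes i s n :: nat
  assumes "i < n" "0 < s" "s < n"
  shows "(i + s) mod n \<noteq> i"
proof (cases "i + s < n")
  case True
  then show ?thesis using assms by simp
next
  case False
  then have "(i + s) mod n = i + s - n" using assms by (simp add: mod_if)
  then show ?thesis using assms False by simp
qed

lemma finite_simple_graph_petersen:
  assumes "n \<ge> 3" "1 \<le> t" "real t \<le> real n / 2"
  shows "finite_simple_graph (petersen n t)"
proof -
  have "i \<noteq> (i + 1) mod n" "i \<noteq> (i + t) mod n" if "i < n" for i
    using add_mod_neq[of i n 1] add_mod_neq[of i n t] that assms by auto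
  then show ?thesis
    using assms by (auto simp: finite_simple_graph_def petersen_def card_2_iff)
qed

end

theory Submission
  imports Defs
begin

text \<open>Write \<open>x\<^sub>i\<close>, \<open>y\<^sub>i\<close>, \<open>w\<^sub>i\<close> for the weights of \<open>u\<^sub>iu\<^sub>i\<^sub>+\<^sub>1\<close>, \<open>v\<^sub>iv\<^sub>i\<^sub>+\<^sub>t\<close>, \<open>u\<^sub>iv\<^sub>i\<close>. Once the \<open>y\<^sub>i\<close> and \<open>w\<^sub>i\<close>
  are fixed, choosing \<open>x\<^sub>0, x\<^sub>1, \<dots>\<close> greedily meets at most two forbidden values at each step,
  except for the three constraints that close the outer cycle: those of \<open>u\<^sub>n\<^sub>-\<^sub>1u\<^sub>0\<close>, \<open>u\<^sub>0u\<^sub>1\<close> and \<open>u\<^sub>0v\<^sub>0\<close>.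
  Two 3-element sets of reals have at most three differences that occur more than once, so
  \<open>w\<^sub>n\<^sub>-\<^sub>1, w\<^sub>0, w\<^sub>1\<close> and \<open>y\<^sub>-\<^sub>t, y\<^sub>0\<close> can be chosen in advance such that each of these three constraints
  excludes only one pair of values; the slack at \<open>x\<^sub>0\<close> and \<open>x\<^sub>1\<close> suffices to avoid these pairs.
  The inner constraints are satisfied greedily by the other \<open>y\<^sub>i\<close>, each of which occurs in only two
  of them. If \<open>n = 2t\<close>, each \<open>y\<^sub>i\<close> occurs in two constraints only and is chosen last. The prism
  \<open>P(3,1)\<close>, where too many of the weights chosen in advance interact, is treated separately.\<close>

section \<open>Choosing from three-element sets of reals\<close>

text \<open>Each of \<open>P\<close> and \<open>Q\<close> excludes at most one element, so one of
  the three survives.\<close>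

lemma card3_avoid:
  assumes "card A = 3"
    and "\<And>a b. a \<in> A \<Longrightarrow> b \<in> A \<Longrightarrow> P a \<Longrightarrow> P b \<Longrightarrow> a = b"
    and "\<And>a b. a \<in> A \<Longrightarrow> b \<in> A \<Longrightarrow> Q a \<Longrightarrow> Q b \<Longrightarrow> a = b"
  shows "\<exists>a\<in>A. \<not> P a \<and> \<not> Q a"
proof -
  obtain a b c where "A = {a, b, c}" "a \<noteq> b" "b \<noteq> c" "a \<noteq> c"
    using assms(1) by (auto simp: card_3_iff)
  then show ?thesis using assms(2,3)[of a b] assms(2,3)[of b c] assms(2,3)[of a c] by blast
qed

lemma card3_avoid_values:
  assumes "card A = 3"
  shows "\<exists>a\<in>A. a \<noteq> u \<and> a \<noteq> v"
  using card3_avoid[OF assms, of "\<lambda>a. a = u" "\<lambda>a. a = v"] by auto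

lemma card3_sorted:
  fixes A :: "'a::linorder set"
  assumes "card A = 3"
  obtains a b c where "A = {a, b, c}" "a < b" "b < c"
proof -
  obtain a b c where A: "A = {a, b, c}" "a \<noteq> b" "b \<noteq> c" "a \<noteq> c"
    using assms by (auto simp: card_3_iff)
  then show ?thesis
    using that[of a b c] that[of a c b] that[of b a c] that[of b c a] that[of c a b] that[of c b a]
    by (smt (verit) insert_commute linorder_less_linear)
qed

text \<open>By cardinality a translate of \<open>C\<close> inside \<open>D\<close> is all of
  \<open>D\<close>, so comparing element sums determines the shift. Hence at most one value of one
  weight can spoil all three values of another.\<close>

lemma translates_in_card3:
  fixes C D :: "real set"
  assumes "card C = 3" "finite D" "card D \<le> 3"
    and "\<And>c. c \<in> C \<Longrightarrow> s + c \<in> D" "\<And>c. c \<in> C \<Longrightarrow> s' + c \<in> D"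
  shows "s = s'"
proof -
  have sum: "\<Sum>D = 3 * r + \<Sum>C" if "\<And>c. c \<in> C \<Longrightarrow> r + c \<in> D" for r
  proof -
    have "(+) r ` C = D"
      using that assms(1-3) by (intro card_seteq) (auto simp: card_image)
    then have "\<Sum>D = (\<Sum>c\<in>C. r + c)"
      by (metis (no_types, lifting) inj_on_add sum.reindex_cong)
    then show ?thesis using assms(1) by (simp add: sum.distrib)
  qed
  show ?thesis using sum[of s] sum[of s'] assms(4,5) by simp
qed

text \<open>These are the differences with at least two representations: distinct representations of
  \<open>d\<close> have distinct first components, which may be ordered as
  \<open>a < a'\<close>.\<close>

definition repeated_diffs :: "real set \<Rightarrow> real set \<Rightarrow> real set" where
  "repeated_diffs A B =
     {d. \<exists>a\<in>A. \<exists>a'\<in>A. \<exists>b\<in>B. \<exists>b'\<in>B. a < a' \<and> a - b = d \<and> a' - b' = d}"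

text \<open>A difference with at most one representation is avoided by giving up a single value of
  \<open>b\<close>. This turns a constraint on two weights into one forbidden value for the
  second.\<close>

lemma not_repeated_diff:
  assumes "d \<notin> repeated_diffs A B"
  shows "\<exists>\<beta>. \<forall>a\<in>A. \<forall>b\<in>B. b \<noteq> \<beta> \<longrightarrow> a - b \<noteq> d"
proof -
  have uniq: "b = b'" if "a \<in> A" "b \<in> B" "a - b = d" "a' \<in> A" "b' \<in> B" "a' - b' = d" for a b a' b'
  proof -
    have "\<not> a < a'" "\<not> a' < a"
      using assms that unfolding repeated_diffs_def by blast+
    then show ?thesis using that by simp
  qed
  show ?thesis
  proof (cases "\<exists>a\<in>A. \<exists>b\<in>B. a - b = d")
    case True
    then show ?thesis using uniq by metis
  qed auto
qed

text \<open>The smaller of two representations uses neither the maximum of \<open>A\<close> nor that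
  of \<open>B\<close>, which leaves four candidates. If these were distinct and all repeated,
  comparing gaps would make all consecutive gaps of \<open>A\<close> and \<open>B\<close> equal, so
  that \<open>a1 - b1 = a2 - b2\<close>.\<close>

lemma card_repeated_diffs:
  assumes "card A = 3" "card B = 3"
  shows "finite (repeated_diffs A B)" "card (repeated_diffs A B) \<le> 3"
proof -
  obtain a1 a2 a3 where A: "A = {a1, a2, a3}" "a1 < a2" "a2 < a3"
    using card3_sorted[OF assms(1)] .
  obtain b1 b2 b3 where B: "B = {b1, b2, b3}" "b1 < b2" "b2 < b3"
    using card3_sorted[OF assms(2)] .
  let ?D = "{a1 - b1, a1 - b2, a2 - b1, a2 - b2}"
  have sub: "repeated_diffs A B \<subseteq> ?D"
    using A B by (auto simp: repeated_diffs_def)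
  show fin: "finite (repeated_diffs A B)"
    using sub finite_subset by blast
  have "repeated_diffs A B \<noteq> ?D \<or> card ?D \<noteq> 4"
  proof (rule ccontr)
    assume "\<not> ?thesis"
    then have eq: "repeated_diffs A B = ?D" and "card ?D = 4" by auto
    then have ne: "a1 - b1 \<noteq> a2 - b2"
      by (auto simp: card_insert_if split: if_splits)
    have "a1 - b2 \<in> repeated_diffs A B" "a2 - b1 \<in> repeated_diffs A B"
      "a1 - b1 \<in> repeated_diffs A B" "a2 - b2 \<in> repeated_diffs A B"
      using eq by auto
    then show False
      using ne A B by (auto simp: repeated_diffs_def)
  qed
  moreover have "card ?D \<le> 4"
    by (simp add: card_insert_if)
  ultimately show "card (repeated_diffs A B) \<le> 3"
    using sub psubset_card_mono[of ?D "repeated_diffs A B"] by fastforce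
qed

text \<open>Otherwise take \<open>a\<close> in \<open>A\<close> outside \<open>B\<close> and
  \<open>b\<close> in \<open>B\<close> outside \<open>A\<close>. By cardinality
  \<open>a + B = T = A + b\<close>, so \<open>B\<close> is \<open>A\<close> shifted by
  \<open>b - a\<close>. Adding \<open>c\<close> in \<open>A\<close> to its own shift shows that
  \<open>A\<close> is closed under \<open>c \<mapsto> 2 * c - a\<close>. This map would have to swap
  the other two elements \<open>r\<close> and \<open>s\<close>, forcing
  \<open>r = s\<close>.\<close>

lemma restricted_sumset_card3:
  fixes A B T :: "real set"
  assumes "card A = 3" "card B = 3" "A \<noteq> B" "finite T" "card T \<le> 3"
  shows "\<exists>a\<in>A. \<exists>b\<in>B. a \<noteq> b \<and> a + b \<notin> T"
proof (rule ccontr)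
  assume "\<not> ?thesis"
  then have in_T: "a + b \<in> T" if "a \<in> A" "b \<in> B" "a \<noteq> b" for a b using that by blast
  have fin: "finite A" "finite B" using assms(1,2) by (auto intro: card_ge_0_finite)
  obtain a where a: "a \<in> A" "a \<notin> B"
    using assms fin by (metis card_subset_eq subsetI)
  obtain b where b: "b \<in> B" "b \<notin> A"
    using assms fin by (metis card_subset_eq subsetI)
  have "(+) a ` B = T"
    using in_T a assms by (intro card_seteq) (auto simp: card_image)
  moreover have "(\<lambda>x. x + b) ` A = T"
    using in_T b assms by (intro card_seteq) (auto simp: card_image)
  ultimately have T: "(+) a ` B = T" "(\<lambda>x. x + b) ` A = T" by auto
  obtain r s where A: "A = {a, r, s}" "a \<noteq> r" "a \<noteq> s" "r \<noteq> s"
  proof -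
    have "card (A - {a}) = 2" using assms(1) a fin by simp
    then obtain r s where "A - {a} = {r, s}" "r \<noteq> s" by (auto simp: card_2_iff)
    then show ?thesis using that[of r s] a by blast
  qed
  have shift: "c + (b - a) \<in> B" if "c \<in> A" for c
  proof -
    have "c + b \<in> (+) a ` B" using T that by blast
    then obtain x where "x \<in> B" "c + b = a + x" by auto
    moreover from this have "x = c + (b - a)" by simp
    ultimately show ?thesis by simp
  qed
  have "b \<noteq> a" using a b by auto
  have "2 * c + (b - a) \<in> (\<lambda>x. x + b) ` A" if "c \<in> A" for c
    using in_T[OF that shift[OF that]] \<open>b \<noteq> a\<close> T by (simp add: algebra_simps)
  then have *: "2 * c \<in> (\<lambda>x. x + a) ` A" if "c \<in> A" for c
    using that by (force simp: image_iff)
  have "2 * r = s + a" "2 * s = r + a"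
    using *[of r] *[of s] A by auto
  then show False using A by linarith
qed

section \<open>Greedy choice along a permutation\<close>

text \<open>A new index \<open>k\<close> takes part in at most two constraints, the one from
  \<open>k\<close> to \<open>\<sigma> k\<close> and the one from its preimage to \<open>k\<close>.
  As \<open>\<sigma>\<close> has no fixed point, each forbids one value.\<close>

lemma greedy_along_permutation:
  fixes d :: "'a \<Rightarrow> real"
  assumes "finite A" "A \<subseteq> I" "inj_on \<sigma> I" "\<And>i. i \<in> I \<Longrightarrow> \<sigma> i \<in> I \<and> \<sigma> i \<noteq> i"
    and "\<And>i. i \<in> A \<Longrightarrow> card (L i) = 3"
  shows "\<exists>f. (\<forall>i\<in>A. f i \<in> L i) \<and> (\<forall>i. i \<notin> A \<longrightarrow> f i = g i) \<and>
    (\<forall>i\<in>I. i \<in> A \<or> \<sigma> i \<in> A \<longrightarrow> f (\<sigma> i) \<noteq> f i + d i)"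
  using assms(1,2,5)
proof (induction A rule: finite_induct)
  case empty
  then show ?case by auto
next
  case (insert k A)
  then obtain f where f: "\<forall>i\<in>A. f i \<in> L i" "\<forall>i. i \<notin> A \<longrightarrow> f i = g i"
    "\<forall>i\<in>I. i \<in> A \<or> \<sigma> i \<in> A \<longrightarrow> f (\<sigma> i) \<noteq> f i + d i" by auto
  have k: "k \<in> I" "card (L k) = 3" using insert.prems by auto
  \<comment> \<open>If \<open>k\<close> has no preimage in \<open>I\<close>, \<open>pre\<close> is
    arbitrary and the value avoided on its account does no harm.\<close>
  define pre where "pre = inv_into I \<sigma> k"
  have pre: "pre = i" if "i \<in> I" "\<sigma> i = k" for i
    using that assms(3) by (auto simp: pre_def)
  obtain v where v: "v \<in> L k" "v \<noteq> f (\<sigma> k) - d k" "v \<noteq> f pre + d pre"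
    using card3_avoid_values[OF k(2)] by blast
  show ?case
  proof (intro exI[of _ "f(k := v)"] conjI ballI allI impI)
    fix i assume i: "i \<in> I" "i \<in> insert k A \<or> \<sigma> i \<in> insert k A"
    show "(f(k := v)) (\<sigma> i) \<noteq> (f(k := v)) i + d i"
    proof (cases "i = k \<or> \<sigma> i = k")
      case True
      then show ?thesis using v pre i assms(4) by fastforce
    qed (use i f in auto)
  qed (use f v in auto)
qed

section \<open>Edges and vertex sums of the generalized Petersen graph\<close>

lemma mod_add_cases:
  fixes i k n :: nat
  assumes "i < n" "k \<le> n"
  shows "(i + k) mod n = (if i + k < n then i + k else i + k - n)"
  using assms by (auto simp: mod_if)

lemma mod_add_diff_cancel:
  fixes i k n :: nat
  assumes "i < n" "k \<le> n"
  shows "((i + k) mod n + (n - k)) mod n = i" "((i + (n - k)) mod n + k) mod n = i"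
proof -
  have "i + k + (n - k) = i + n" "i + (n - k) + k = i + n" using assms by auto
  then show "((i + k) mod n + (n - k)) mod n = i" "((i + (n - k)) mod n + k) mod n = i"
    unfolding mod_add_left_eq using assms(1) by auto
qed

text \<open>One family covers the outer edges (\<open>f = U\<close>, \<open>k = 1\<close>) and the
  inner edges (\<open>f = V\<close>, \<open>k = t\<close>), each indexed by its starting
  point.\<close>

definition ring_edge :: "(nat \<Rightarrow> 'a) \<Rightarrow> nat \<Rightarrow> nat \<Rightarrow> nat \<Rightarrow> 'a set" where
  "ring_edge f n k i = {f i, f ((i + k) mod n)}"

text \<open>If the ends are swapped, then \<open>i = j + k\<close> and \<open>j = i + k\<close>
  modulo \<open>n\<close>, so \<open>n\<close> divides \<open>2 * k\<close>.\<close>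

lemma ring_edge_eq_imp:
  assumes "inj f" "1 \<le> k" "2 * k \<le> n" "i < n" "j < n"
    and "ring_edge f n k i = ring_edge f n k j"
  shows "i = j \<or> 2 * k = n \<and> i = (j + k) mod n"
  using assms by (auto simp: ring_edge_def doubleton_eq_iff inj_eq mod_add_cases split: if_splits)

lemma inj_on_ring_edge:
  assumes "inj f" "1 \<le> k" "2 * k < n"
  shows "inj_on (ring_edge f n k) {..<n}"
  using assms ring_edge_eq_imp[of f k n] by (intro inj_onI) auto

lemma mem_ring_edge_iff:
  assumes "inj f" "k \<le> n" "i < n" "j < n"
  shows "f i \<in> ring_edge f n k j \<longleftrightarrow> j = i \<or> j = (i + (n - k)) mod n"
  unfolding ring_edge_def mod_add_cases[OF assms(4,2)] mod_add_cases[OF assms(3) diff_le_self]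
  using assms by (auto simp: inj_eq)

lemma inj_U: "inj U" and inj_V: "inj V"
  by (auto simp: inj_def)

lemma edges_petersen:
  "edges (petersen n t) =
     ring_edge U n 1 ` {..<n} \<union> ring_edge V n t ` {..<n} \<union> (\<lambda>i. {U i, V i}) ` {..<n}"
  by (auto simp: petersen_def ring_edge_def)

lemma ring_edges_disjoint:
  "ring_edge U n k i \<noteq> ring_edge V m l j" "{U i, V i'} \<noteq> ring_edge U n k j"
  "{U i, V i'} \<noteq> ring_edge V n k j"
  by (auto simp: ring_edge_def doubleton_eq_iff)

lemma petersen_edge_weighting:
  fixes x y w :: "nat \<Rightarrow> real"
  assumes "n \<ge> 3" "1 \<le> t" "2 * t \<le> n"
    and "2 * t = n \<Longrightarrow> \<forall>i<n. y ((i + t) mod n) = y i"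
  obtains \<psi> where "\<And>i. i < n \<Longrightarrow> \<psi> (ring_edge U n 1 i) = x i"
    "\<And>i. i < n \<Longrightarrow> \<psi> (ring_edge V n t i) = y i"
    "\<And>i. i < n \<Longrightarrow> \<psi> {U i, V i} = w i"
proof -
  let ?u = "ring_edge U n 1" and ?v = "ring_edge V n t" and ?s = "\<lambda>i. {U i, V i}"
  define \<psi> where "\<psi> e =
    (if e \<in> ?u ` {..<n} then x (inv_into {..<n} ?u e)
     else if e \<in> ?v ` {..<n} then y (inv_into {..<n} ?v e)
     else w (inv_into {..<n} ?s e))" for e
  show ?thesis
  proof (rule that)
    fix i assume i: "i < n"
    have "inj_on ?u {..<n}"
      using assms by (intro inj_on_ring_edge inj_U) auto
    then show "\<psi> (?u i) = x i"
      using i by (simp add: \<psi>_def)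
    have "?s i \<notin> ?u ` {..<n}" "?s i \<notin> ?v ` {..<n}" "inj_on ?s {..<n}"
      using ring_edges_disjoint by (auto simp: inj_on_def doubleton_eq_iff)
    then show "\<psi> (?s i) = w i"
      using i inv_into_f_f[of ?s "{..<n}" i] by (simp add: \<psi>_def)
    have "?v i \<notin> ?u ` {..<n}" using ring_edges_disjoint by (metis imageE)
    \<comment> \<open>For \<open>2 * t = n\<close> the inverse may return the opposite index
      \<open>i + t\<close>; the periodicity of \<open>y\<close> makes the weight independent of this
      choice.\<close>
    moreover define j where "j = inv_into {..<n} ?v (?v i)"
    have "?v i \<in> ?v ` {..<n}" using i by blast
    then have "j < n" "?v j = ?v i"
      unfolding j_def using inv_into_into[of "?v i" ?v "{..<n}"] f_inv_into_f[of "?v i" ?v "{..<n}"]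
      by auto
    then have "y j = y i"
      using ring_edge_eq_imp[OF inj_V assms(2,3) \<open>j < n\<close> i] assms(4) i by auto
    ultimately show "\<psi> (?v i) = y i"
      using \<open>?v i \<in> ?v ` {..<n}\<close> unfolding \<psi>_def j_def by simp
  qed
qed

lemma incident_edges_petersen:
  assumes "n \<ge> 3" "1 \<le> t" "2 * t \<le> n" "i < n"
  shows "incident_edges (petersen n t) (U i) =
      {ring_edge U n 1 ((i + (n - 1)) mod n), ring_edge U n 1 i, {U i, V i}}"
    and "incident_edges (petersen n t) (V i) =
      {ring_edge V n t ((i + (n - t)) mod n), ring_edge V n t i, {U i, V i}}"
proof -
  have "U i \<notin> ring_edge V n t j" "V i \<notin> ring_edge U n 1 j" for j
    by (auto simp: ring_edge_def)
  moreover have "(i + (n - 1)) mod n < n" "(i + (n - t)) mod n < n"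
    using assms by auto
  moreover have "U i \<in> ring_edge U n 1 j \<longleftrightarrow> j = i \<or> j = (i + (n - 1)) mod n"
    "V i \<in> ring_edge V n t j \<longleftrightarrow> j = i \<or> j = (i + (n - t)) mod n" if "j < n" for j
    using mem_ring_edge_iff[OF inj_U _ assms(4) that, of 1]
      mem_ring_edge_iff[OF inj_V _ assms(4) that, of t] assms by auto
  ultimately show "incident_edges (petersen n t) (U i) =
      {ring_edge U n 1 ((i + (n - 1)) mod n), ring_edge U n 1 i, {U i, V i}}"
    "incident_edges (petersen n t) (V i) =
      {ring_edge V n t ((i + (n - t)) mod n), ring_edge V n t i, {U i, V i}}"
    using assms(4) unfolding incident_edges_def edges_petersen by (blast | force)+
qed

text \<open>The ring edges at a vertex have indices \<open>i - k\<close> and \<open>i\<close>, the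
  former written \<open>i + (n - k)\<close> to stay within the naturals. For
  \<open>2 * t = n\<close> the two inner ones coincide and count once.\<close>

lemma vertex_sum_petersen:
  assumes "n \<ge> 3" "1 \<le> t" "2 * t \<le> n" "i < n"
  shows "vertex_sum (petersen n t) \<phi> \<psi> (U i) = \<phi> (U i) +
      (\<psi> (ring_edge U n 1 ((i + (n - 1)) mod n)) + \<psi> (ring_edge U n 1 i)) + \<psi> {U i, V i}"
    and "vertex_sum (petersen n t) \<phi> \<psi> (V i) = \<phi> (V i) +
      (if 2 * t = n then \<psi> (ring_edge V n t i)
       else \<psi> (ring_edge V n t ((i + (n - t)) mod n)) + \<psi> (ring_edge V n t i)) + \<psi> {U i, V i}"
proof -
  have ne: "(i + (n - k)) mod n \<noteq> i" if "1 \<le> k" "2 * k \<le> n" for k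
    using add_mod_neq[of i n "n - k"] that assms by auto
  have inj: "ring_edge f n k ((i + (n - k)) mod n) \<noteq> ring_edge f n k i"
    if "inj f" "1 \<le> k" "2 * k < n" for f :: "nat \<Rightarrow> petersen_vertex" and k
    using inj_on_ring_edge[OF that] ne[of k] that assms by (auto simp: inj_on_def)
  show "vertex_sum (petersen n t) \<phi> \<psi> (U i) = \<phi> (U i) +
      (\<psi> (ring_edge U n 1 ((i + (n - 1)) mod n)) + \<psi> (ring_edge U n 1 i)) + \<psi> {U i, V i}"
    using inj[OF inj_U, of 1] assms ring_edges_disjoint(2)[of i i n 1, symmetric]
    by (simp add: vertex_sum_def incident_edges_petersen(1)[OF assms])
  have "ring_edge V n t ((i + (n - t)) mod n) = ring_edge V n t i" if "2 * t = n"
    using that assms by (auto simp: ring_edge_def mod_add_cases)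
  then show "vertex_sum (petersen n t) \<phi> \<psi> (V i) = \<phi> (V i) +
      (if 2 * t = n then \<psi> (ring_edge V n t i)
       else \<psi> (ring_edge V n t ((i + (n - t)) mod n)) + \<psi> (ring_edge V n t i)) + \<psi> {U i, V i}"
    using inj[OF inj_V, of t] assms ring_edges_disjoint(3)[of i i n t, symmetric]
    by (simp add: vertex_sum_def incident_edges_petersen(2)[OF assms])
qed

section \<open>Reduction to inequalities between weight sequences\<close>

lemma proper_total_weighting_petersen:
  assumes "\<And>i. i < n \<Longrightarrow> vertex_sum (petersen n t) \<phi> \<psi> (U i) \<noteq>
      vertex_sum (petersen n t) \<phi> \<psi> (U ((i + 1) mod n))"
    and "\<And>i. i < n \<Longrightarrow> vertex_sum (petersen n t) \<phi> \<psi> (V i) \<noteq>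
      vertex_sum (petersen n t) \<phi> \<psi> (V ((i + t) mod n))"
    and "\<And>i. i < n \<Longrightarrow> vertex_sum (petersen n t) \<phi> \<psi> (U i) \<noteq>
      vertex_sum (petersen n t) \<phi> \<psi> (V i)"
  shows "proper_total_weighting (petersen n t) \<phi> \<psi>"
  unfolding proper_total_weighting_def
proof (intro allI impI)
  fix a b assume "{a, b} \<in> edges (petersen n t)"
  then obtain i where "i < n" "{a, b} = {U i, U ((i + 1) mod n)} \<or>
      {a, b} = {V i, V ((i + t) mod n)} \<or> {a, b} = {U i, V i}"
    by (auto simp: edges_petersen ring_edge_def)
  then show "vertex_sum (petersen n t) \<phi> \<psi> a \<noteq> vertex_sum (petersen n t) \<phi> \<psi> b"
    using assms[of i] by (auto simp: doubleton_eq_iff)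
qed

text \<open>The weights of \<open>u\<^sub>iu\<^sub>i\<^sub>+\<^sub>1\<close>, \<open>v\<^sub>iv\<^sub>i\<^sub>+\<^sub>t\<close> and \<open>u\<^sub>iv\<^sub>i\<close> are \<open>x i\<close>, \<open>y i\<close> and \<open>w i\<close>;
  \<open>\<alpha>\<close> and \<open>\<beta>\<close> are the prescribed weights of the outer and the inner vertices.\<close>

definition outer_sum ::
    "nat \<Rightarrow> (nat \<Rightarrow> real) \<Rightarrow> (nat \<Rightarrow> real) \<Rightarrow> (nat \<Rightarrow> real) \<Rightarrow> nat \<Rightarrow> real" where
  "outer_sum n \<alpha> x w i = \<alpha> i + (x ((i + (n - 1)) mod n) + x i) + w i"

definition inner_sum ::
    "nat \<Rightarrow> nat \<Rightarrow> (nat \<Rightarrow> real) \<Rightarrow> (nat \<Rightarrow> real) \<Rightarrow> (nat \<Rightarrow> real) \<Rightarrow> nat \<Rightarrow> real" where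
  "inner_sum n t \<beta> y w i =
     \<beta> i + (if 2 * t = n then y i else y ((i + (n - t)) mod n) + y i) + w i"

text \<open>One-element vertex lists force the vertex weights, hence the arbitrary reals
  \<open>\<alpha>\<close> and \<open>\<beta>\<close>. The periodicity conditions reflect that for
  \<open>2 * t = n\<close> the indices \<open>i\<close> and \<open>i + t\<close> name the same inner
  edge.\<close>

definition solvable :: "nat \<Rightarrow> nat \<Rightarrow> bool" where
  "solvable n t \<longleftrightarrow> (\<forall>\<alpha> \<beta> X Y W.
     (\<forall>i<n. card (X i) = 3 \<and> card (Y i) = 3 \<and> card (W i) = 3) \<and>
     (2 * t = n \<longrightarrow> (\<forall>i<n. Y ((i + t) mod n) = Y i)) \<longrightarrow>
     (\<exists>x y w. (\<forall>i<n. x i \<in> X i \<and> y i \<in> Y i \<and> w i \<in> W i) \<and>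
       (2 * t = n \<longrightarrow> (\<forall>i<n. y ((i + t) mod n) = y i)) \<and>
       (\<forall>i<n. outer_sum n \<alpha> x w i \<noteq> outer_sum n \<alpha> x w ((i + 1) mod n)) \<and>
       (\<forall>i<n. inner_sum n t \<beta> y w i \<noteq> inner_sum n t \<beta> y w ((i + t) mod n)) \<and>
       (\<forall>i<n. outer_sum n \<alpha> x w i \<noteq> inner_sum n t \<beta> y w i)))"

lemma choosable_if_solvable:
  assumes "n \<ge> 3" "1 \<le> t" "2 * t \<le> n" "solvable n t"
  shows "choosable 1 3 (petersen n t)"
  unfolding choosable_def
proof (intro allI impI)
  fix L :: "petersen_vertex \<Rightarrow> real set" and M :: "petersen_vertex set \<Rightarrow> real set"
  assume LM: "(\<forall>x\<in>verts (petersen n t). finite (L x) \<and> card (L x) = 1) \<and>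
     (\<forall>e\<in>edges (petersen n t). finite (M e) \<and> card (M e) = 3)"
  have "\<forall>v\<in>verts (petersen n t). \<exists>r. r \<in> L v"
    using LM by (metis card.empty ex_in_conv zero_neq_one)
  then obtain \<phi> where \<phi>: "\<forall>v\<in>verts (petersen n t). \<phi> v \<in> L v" by metis
  define X Y W where "X i = M (ring_edge U n 1 i)" and "Y i = M (ring_edge V n t i)"
    and "W i = M {U i, V i}" for i
  define \<alpha> \<beta> where "\<alpha> i = \<phi> (U i)" and "\<beta> i = \<phi> (V i)" for i
  have cards: "\<forall>i<n. card (X i) = 3 \<and> card (Y i) = 3 \<and> card (W i) = 3"
    using LM by (auto simp: edges_petersen X_def Y_def W_def)
  have Y_eq: "2 * t = n \<longrightarrow> (\<forall>i<n. Y ((i + t) mod n) = Y i)"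
  proof (intro impI allI)
    fix i assume that: "2 * t = n" "i < n"
    have "ring_edge V n t ((i + t) mod n) = ring_edge V n t i"
      using that by (auto simp: ring_edge_def mod_add_cases)
    then show "Y ((i + t) mod n) = Y i" by (simp add: Y_def)
  qed
  obtain x y w where mem: "\<forall>i<n. x i \<in> X i \<and> y i \<in> Y i \<and> w i \<in> W i"
    and y: "2 * t = n \<longrightarrow> (\<forall>i<n. y ((i + t) mod n) = y i)"
    and neq: "\<forall>i<n. outer_sum n \<alpha> x w i \<noteq> outer_sum n \<alpha> x w ((i + 1) mod n)"
       "\<forall>i<n. inner_sum n t \<beta> y w i \<noteq> inner_sum n t \<beta> y w ((i + t) mod n)"
       "\<forall>i<n. outer_sum n \<alpha> x w i \<noteq> inner_sum n t \<beta> y w i"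
    using assms(4)[unfolded solvable_def, THEN spec[of _ \<alpha>], THEN spec[of _ \<beta>], THEN spec,
        THEN spec, THEN spec, THEN mp, OF conjI[OF cards Y_eq]]
    by (elim exE conjE) (rule that)
  obtain \<psi> where \<psi>: "\<And>i. i < n \<Longrightarrow> \<psi> (ring_edge U n 1 i) = x i"
    "\<And>i. i < n \<Longrightarrow> \<psi> (ring_edge V n t i) = y i" "\<And>i. i < n \<Longrightarrow> \<psi> {U i, V i} = w i"
    using petersen_edge_weighting[of n t y x w] assms y by blast
  have sums: "vertex_sum (petersen n t) \<phi> \<psi> (U i) = outer_sum n \<alpha> x w i"
    "vertex_sum (petersen n t) \<phi> \<psi> (V i) = inner_sum n t \<beta> y w i" if "i < n" for i
    using that vertex_sum_petersen[OF assms(1-3) that] \<psi>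
    by (simp_all add: outer_sum_def inner_sum_def \<alpha>_def \<beta>_def)
  show "\<exists>\<phi> \<psi>. (\<forall>x\<in>verts (petersen n t). \<phi> x \<in> L x) \<and> (\<forall>e\<in>edges (petersen n t). \<psi> e \<in> M e) \<and>
      proper_total_weighting (petersen n t) \<phi> \<psi>"
  proof (intro exI conjI proper_total_weighting_petersen)
    show "\<forall>e\<in>edges (petersen n t). \<psi> e \<in> M e"
      using mem \<psi> by (auto simp: edges_petersen X_def Y_def W_def)
  qed (use \<phi> neq sums in auto)
qed

text \<open>The weight \<open>x i\<close> of the common edge cancels, leaving only the ring edges
  before and after it.\<close>

lemma outer_sum_neq_next:
  assumes "i < n" "1 < n"
    and "\<alpha> i + x ((i + (n - 1)) mod n) + w i \<noteq>
      \<alpha> ((i + 1) mod n) + x ((i + 1) mod n) + w ((i + 1) mod n)"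
  shows "outer_sum n \<alpha> x w i \<noteq> outer_sum n \<alpha> x w ((i + 1) mod n)"
proof -
  have "((i + 1) mod n + (n - 1)) mod n = i"
    using assms(1,2) by (intro mod_add_diff_cancel) auto
  then show ?thesis using assms(3) by (simp add: outer_sum_def)
qed

lemma inner_sum_neq_next:
  assumes "i < n" "2 * t < n"
    and "\<beta> i + y ((i + (n - t)) mod n) + w i \<noteq>
      \<beta> ((i + t) mod n) + y ((i + t) mod n) + w ((i + t) mod n)"
  shows "inner_sum n t \<beta> y w i \<noteq> inner_sum n t \<beta> y w ((i + t) mod n)"
proof -
  have "((i + t) mod n + (n - t)) mod n = i"
    using assms(1,2) by (intro mod_add_diff_cancel) auto
  moreover have "(2 * t = n) = False" using assms(2) by simp
  ultimately show ?thesis using assms(3) by (simp add: inner_sum_def)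
qed

text \<open>After cancellation the constraint at \<open>i\<close> links the indices
  \<open>i - k\<close> and \<open>i + k\<close>, so the relevant permutation is the shift by
  \<open>2 * k\<close>, free of fixed points because \<open>0 < 2 * k < n\<close>. Indices outside
  \<open>A\<close> keep the values of \<open>g\<close>.\<close>

lemma greedy_on_ring:
  fixes a w g :: "nat \<Rightarrow> real"
  assumes "0 < k" "2 * k < n" "A \<subseteq> {..<n}" "\<And>i. i \<in> A \<Longrightarrow> card (L i) = 3"
  obtains f where "\<And>i. i \<in> A \<Longrightarrow> f i \<in> L i" "\<And>i. i \<notin> A \<Longrightarrow> f i = g i"
    "\<And>i. i < n \<Longrightarrow> (i + (n - k)) mod n \<in> A \<or> (i + k) mod n \<in> A \<Longrightarrow>
      a i + f ((i + (n - k)) mod n) + w i \<noteq> a ((i + k) mod n) + f ((i + k) mod n) + w ((i + k) mod n)"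
proof -
  let ?\<sigma> = "\<lambda>i. (i + 2 * k) mod n"
  define d where "d i = a ((i + k) mod n) + w ((i + k) mod n) - a (?\<sigma> i) - w (?\<sigma> i)" for i
  have \<sigma>: "inj_on ?\<sigma> {..<n}" "\<And>i. i \<in> {..<n} \<Longrightarrow> ?\<sigma> i \<in> {..<n} \<and> ?\<sigma> i \<noteq> i"
    using assms(1,2) by (auto simp: inj_on_def mod_add_cases split: if_splits)
  have "finite A" using assms(3) finite_subset by blast
  from greedy_along_permutation[OF this assms(3) \<sigma>, where L = L and g = g and d = d] assms(4)
  obtain f where f: "\<forall>i\<in>A. f i \<in> L i" "\<forall>i. i \<notin> A \<longrightarrow> f i = g i"
    "\<forall>i\<in>{..<n}. i \<in> A \<or> ?\<sigma> i \<in> A \<longrightarrow> f (?\<sigma> i) \<noteq> f i + d i" by blast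
  show ?thesis
  proof (rule that)
    fix i assume i: "i < n" "(i + (n - k)) mod n \<in> A \<or> (i + k) mod n \<in> A"
    \<comment> \<open>The constraint at \<open>i\<close> is reindexed by its lower end
      \<open>j = i - k\<close>.\<close>
    define j where "j = (i + (n - k)) mod n"
    have j: "j < n" "(j + k) mod n = i"
      using i(1) assms(1,2) mod_add_diff_cancel(2)[of i n k] unfolding j_def by auto
    have \<sigma>j: "?\<sigma> j = (i + k) mod n"
      using mod_add_left_eq[of "j + k" n k] by (simp add: j(2) mult_2 add.assoc)
    have "j \<in> A \<or> ?\<sigma> j \<in> A" using i(2) unfolding \<sigma>j unfolding j_def .
    then have "f (?\<sigma> j) \<noteq> f j + d j" using f(3) j(1) by blast
    then show "a i + f ((i + (n - k)) mod n) + w i \<noteq>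
        a ((i + k) mod n) + f ((i + k) mod n) + w ((i + k) mod n)"
      unfolding d_def \<sigma>j j(2) j_def[symmetric] by argo
  qed (use f in auto)
qed

section \<open>The case n = 2t and the prism\<close>

lemma solvable_half:
  assumes "n = 2 * t" "n \<ge> 3"
  shows "solvable n t"
  unfolding solvable_def
proof (intro allI impI)
  fix \<alpha> \<beta> :: "nat \<Rightarrow> real" and X Y W :: "nat \<Rightarrow> real set"
  assume "(\<forall>i<n. card (X i) = 3 \<and> card (Y i) = 3 \<and> card (W i) = 3) \<and>
    (2 * t = n \<longrightarrow> (\<forall>i<n. Y ((i + t) mod n) = Y i))"
  then have X: "\<And>i. i < n \<Longrightarrow> card (X i) = 3" and Y: "\<And>i. i < n \<Longrightarrow> card (Y i) = 3"
    and W: "\<And>i. i < n \<Longrightarrow> card (W i) = 3" and Y_eq: "\<And>i. i < n \<Longrightarrow> Y ((i + t) mod n) = Y i"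
    using assms by auto
  let ?r = "\<lambda>i. (i + t) mod n"
  have r: "?r i = (if i < t then i + t else i - t)" if "i < n" for i
    using that assms by (auto simp: mod_add_cases)
  have "\<forall>i<n. \<exists>v. v \<in> W i"
    using W by (metis card.empty ex_in_conv zero_neq_numeral)
  then obtain w0 where w0: "\<And>i. i < n \<Longrightarrow> w0 i \<in> W i" by metis
  \<comment> \<open>The inner weight cancels in the constraint of its own edge, so only two spokes
    matter: those with \<open>i < t\<close> take \<open>w0\<close>, and their opposites adapt
    through \<open>w1\<close>.\<close>
  have "\<forall>i<n. \<exists>v\<in>W i. v \<noteq> \<beta> (?r i) + w0 (?r i) - \<beta> i"
    using card3_avoid_values[OF W] by meson
  then obtain w1 where w1: "\<And>i. i < n \<Longrightarrow> w1 i \<in> W i \<and> w1 i \<noteq> \<beta> (?r i) + w0 (?r i) - \<beta> i"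
    by metis
  define w where "w i = (if i < t then w0 i else w1 i)" for i
  have w_mem: "w i \<in> W i" if "i < n" for i
    using w0 w1 that by (simp add: w_def)
  have w: "\<beta> i + w i \<noteq> \<beta> (?r i) + w (?r i)" if "i < n" for i
    using w1[of i] w1[of "i + t"] that assms r[of i] r[of "i + t"] by (auto simp: w_def)
  obtain x where x_mem: "\<And>i. i \<in> {..<n} \<Longrightarrow> x i \<in> X i"
    and x: "\<And>i. i < n \<Longrightarrow> (i + (n - 1)) mod n \<in> {..<n} \<or> (i + 1) mod n \<in> {..<n} \<Longrightarrow>
      \<alpha> i + x ((i + (n - 1)) mod n) + w i \<noteq>
      \<alpha> ((i + 1) mod n) + x ((i + 1) mod n) + w ((i + 1) mod n)"
    by (rule greedy_on_ring[of 1 n "{..<n}" X "\<lambda>_. 0" \<alpha> w]) (use X assms(2) in auto)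
  \<comment> \<open>\<open>e i\<close> is the one value of \<open>y i\<close> that would violate the
    constraint of the spoke at \<open>i\<close>; the spoke weight cancels.\<close>
  define e where "e i = \<alpha> i + (x ((i + (n - 1)) mod n) + x i) - \<beta> i" for i
  have "\<forall>i<n. \<exists>v\<in>Y i. v \<noteq> e i \<and> v \<noteq> e (i + t)"
    using card3_avoid_values[OF Y] by meson
  then obtain v where v: "\<And>i. i < n \<Longrightarrow> v i \<in> Y i \<and> v i \<noteq> e i \<and> v i \<noteq> e (i + t)"
    by metis
  \<comment> \<open>Both ends of an inner edge read the value chosen at the end with index below
    \<open>t\<close>, which avoids the forbidden values of both spokes.\<close>
  define y where "y i = v (if i < t then i else i - t)" for i
  have y_mem: "y i \<in> Y i" and y: "y i \<noteq> e i" and y_eq: "y (?r i) = y i" if "i < n" for i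
  proof -
    have "i - t < n" "\<not> i < t \<Longrightarrow> i - t < t" using that assms(1) by auto
    then show "y i \<in> Y i" "y i \<noteq> e i" "y (?r i) = y i"
      using v[OF that] v[of "i - t"] Y_eq[of "i - t"] r[OF that] r[of "i - t"]
      by (auto simp: y_def)
  qed
  show "\<exists>x y w. (\<forall>i<n. x i \<in> X i \<and> y i \<in> Y i \<and> w i \<in> W i) \<and>
       (2 * t = n \<longrightarrow> (\<forall>i<n. y ((i + t) mod n) = y i)) \<and>
       (\<forall>i<n. outer_sum n \<alpha> x w i \<noteq> outer_sum n \<alpha> x w ((i + 1) mod n)) \<and>
       (\<forall>i<n. inner_sum n t \<beta> y w i \<noteq> inner_sum n t \<beta> y w ((i + t) mod n)) \<and>
       (\<forall>i<n. outer_sum n \<alpha> x w i \<noteq> inner_sum n t \<beta> y w i)"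
  proof (rule exI[of _ x], rule exI[of _ y], rule exI[of _ w], intro conjI allI impI)
    fix i assume i: "i < n"
    show "outer_sum n \<alpha> x w i \<noteq> outer_sum n \<alpha> x w ((i + 1) mod n)"
      using i x[OF i] assms(2) by (intro outer_sum_neq_next) auto
    show "inner_sum n t \<beta> y w i \<noteq> inner_sum n t \<beta> y w ((i + t) mod n)"
      using w[OF i] y_eq[OF i] assms by (simp add: inner_sum_def)
    show "outer_sum n \<alpha> x w i \<noteq> inner_sum n t \<beta> y w i"
      using y[OF i] assms by (simp add: inner_sum_def outer_sum_def e_def)
  qed (use x_mem y_mem w_mem y_eq in auto)
qed

text \<open>Here \<open>x\<^sub>k\<close> and \<open>y\<^sub>k\<close> are the weights of the triangle edges opposite to the \<open>k\<close>-th vertex. The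
  choice of \<open>w\<^sub>2\<close> allows an \<open>x\<^sub>1\<close> that never conflicts with \<open>x\<^sub>2\<close>, and then \<open>y\<^sub>1, y\<^sub>2\<close> for which the third
  spoke does not restrict \<open>x\<^sub>2\<close> either.\<close>

lemma prism_weights:
  fixes a1 a2 a3 b1 b2 b3 :: real
  assumes X: "card X1 = 3" "card X2 = 3" "card X3 = 3"
    and Y: "card Y1 = 3" "card Y2 = 3" "card Y3 = 3"
    and W: "card W1 = 3" "card W2 = 3" "card W3 = 3"
  shows "\<exists>x1\<in>X1. \<exists>x2\<in>X2. \<exists>x3\<in>X3. \<exists>y1\<in>Y1. \<exists>y2\<in>Y2. \<exists>y3\<in>Y3. \<exists>w1\<in>W1. \<exists>w2\<in>W2. \<exists>w3\<in>W3.
    a1 + w1 - x1 \<noteq> a2 + w2 - x2 \<and> a1 + w1 - x1 \<noteq> a3 + w3 - x3 \<and> a2 + w2 - x2 \<noteq> a3 + w3 - x3 \<and>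
    b1 + w1 - y1 \<noteq> b2 + w2 - y2 \<and> b1 + w1 - y1 \<noteq> b3 + w3 - y3 \<and> b2 + w2 - y2 \<noteq> b3 + w3 - y3 \<and>
    a1 + x2 + x3 \<noteq> b1 + y2 + y3 \<and> a2 + x1 + x3 \<noteq> b2 + y1 + y3 \<and> a3 + x1 + x2 \<noteq> b3 + y1 + y2"
proof -
  have fin: "finite X1" "finite X2" "finite Y1" "finite Y2"
    using X Y by (auto intro: card_ge_0_finite)
  have card_refl: "card ((\<lambda>x. c - x) ` A) = card A" for c :: real and A
    by (rule card_image) (auto simp: inj_on_def)
  obtain w1 where w1: "w1 \<in> W1" using W by fastforce
  obtain w3 where w3: "w3 \<in> W3" using W by fastforce
  have uniq: "w = w'"
    if "card B = 3" "S = (\<lambda>x. c + w - x) ` B" "S = (\<lambda>x. c + w' - x) ` B" for S B and c w w' :: real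
  proof -
    have "card S = 3" using that card_refl by simp
    then have "c + w = c + w'"
      using that by (intro translates_in_card3[of "uminus ` B" S])
        (auto simp: card_image intro: card_ge_0_finite)
    then show ?thesis by simp
  qed
  have "\<exists>w2\<in>W2. \<not> (\<lambda>x. a1 + w1 - x) ` X1 = (\<lambda>x. a2 + w2 - x) ` X2 \<and>
    \<not> (\<lambda>x. b1 + w1 - x) ` Y1 = (\<lambda>x. b2 + w2 - x) ` Y2"
    by (rule card3_avoid[OF W(2)]) (rule uniq[OF X(2)] uniq[OF Y(2)]; assumption)+
  then obtain w2 where w2: "w2 \<in> W2" "(\<lambda>x. a1 + w1 - x) ` X1 \<noteq> (\<lambda>x. a2 + w2 - x) ` X2"
    "(\<lambda>x. b1 + w1 - x) ` Y1 \<noteq> (\<lambda>x. b2 + w2 - x) ` Y2" by blast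
  \<comment> \<open>Distinct sets of equal finite size are not nested, which yields an
    \<open>x1\<close> that conflicts with no \<open>x2\<close>.\<close>
  have "\<not> (\<lambda>x. a1 + w1 - x) ` X1 \<subseteq> (\<lambda>x. a2 + w2 - x) ` X2"
    using w2(2) fin X card_subset_eq[of "(\<lambda>x. a2 + w2 - x) ` X2" "(\<lambda>x. a1 + w1 - x) ` X1"]
    by (auto simp: card_refl)
  then obtain x1 where x1: "x1 \<in> X1" "\<And>x2. x2 \<in> X2 \<Longrightarrow> a1 + w1 - x1 \<noteq> a2 + w2 - x2"
    by blast
  define T where "T = (\<lambda>x. (b1 + w1 + b2 + w2 + b3 - a3 - x1) - x) ` X2"
  have "finite T" "card T \<le> 3" using fin X by (auto simp: T_def card_refl)
  then obtain y1 y2 where y12: "y1 \<in> Y1" "y2 \<in> Y2" "b1 + w1 - y1 \<noteq> b2 + w2 - y2"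
    "(b1 + w1 - y1) + (b2 + w2 - y2) \<notin> T"
    using restricted_sumset_card3[OF _ _ w2(3), of T] Y by (auto simp: card_refl)
  have T: "a3 + x1 + x2 \<noteq> b3 + y1 + y2" if "x2 \<in> X2" for x2
    using y12(4) that unfolding T_def image_iff by (auto dest!: bspec[of _ _ x2])
  \<comment> \<open>Two constraints remain for each weight: \<open>y3\<close> settles the inner
    edges at the third vertex, \<open>x3\<close> an outer edge and the second spoke,
    \<open>x2\<close> an outer edge and the first spoke.\<close>
  obtain y3 where y3: "y3 \<in> Y3" "y3 \<noteq> b3 + w3 - (b1 + w1 - y1)" "y3 \<noteq> b3 + w3 - (b2 + w2 - y2)"
    using card3_avoid_values[OF Y(3)] by blast
  obtain x3 where x3: "x3 \<in> X3" "x3 \<noteq> a3 + w3 - (a1 + w1 - x1)" "x3 \<noteq> b2 + y1 + y3 - a2 - x1"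
    using card3_avoid_values[OF X(3)] by blast
  obtain x2 where x2: "x2 \<in> X2" "x2 \<noteq> a2 + w2 - (a3 + w3 - x3)" "x2 \<noteq> b1 + y2 + y3 - a1 - x3"
    using card3_avoid_values[OF X(2)] by blast
  show ?thesis
    by (rule bexI[of _ x1], rule bexI[of _ x2], rule bexI[of _ x3], rule bexI[of _ y1],
        rule bexI[of _ y2], rule bexI[of _ y3], rule bexI[of _ w1], rule bexI[of _ w2],
        rule bexI[of _ w3], intro conjI)
      (use x1 x1(2)[OF x2(1)] x2 x3 y12 y3 w1 w2(1) w3 T[OF x2(1)] in simp_all)
qed

text \<open>The edges opposite to the vertices 0, 1, 2 of a triangle have indices 1, 2, 0.
  Subtracting the total edge weight of the triangle from a vertex sum leaves the opposite edge with
  a minus sign, as in \<open>prism_weights\<close>.\<close>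

lemma solvable_prism: "solvable 3 1"
  unfolding solvable_def
proof (intro allI impI)
  fix \<alpha> \<beta> :: "nat \<Rightarrow> real" and X Y W :: "nat \<Rightarrow> real set"
  assume "(\<forall>i<3. card (X i) = 3 \<and> card (Y i) = 3 \<and> card (W i) = 3) \<and>
    (2 * 1 = (3::nat) \<longrightarrow> (\<forall>i<3. Y ((i + 1) mod 3) = Y i))"
  then have card: "card (X i) = 3" "card (Y i) = 3" "card (W i) = 3" if "i < 3" for i
    using that by auto
  have all3: "(\<forall>i<3. P i) \<longleftrightarrow> P 0 \<and> P 1 \<and> P 2" for P :: "nat \<Rightarrow> bool"
    by (auto simp: less_Suc_eq numeral_3_eq_3 numeral_2_eq_2)
  obtain x1 x2 x0 y1 y2 y0 w0 w1 w2 where mem: "x1 \<in> X 1" "x2 \<in> X 2" "x0 \<in> X 0"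
     "y1 \<in> Y 1" "y2 \<in> Y 2" "y0 \<in> Y 0" "w0 \<in> W 0" "w1 \<in> W 1" "w2 \<in> W 2" and neq:
    "\<alpha> 0 + w0 - x1 \<noteq> \<alpha> 1 + w1 - x2" "\<alpha> 0 + w0 - x1 \<noteq> \<alpha> 2 + w2 - x0"
    "\<alpha> 1 + w1 - x2 \<noteq> \<alpha> 2 + w2 - x0"
    "\<beta> 0 + w0 - y1 \<noteq> \<beta> 1 + w1 - y2" "\<beta> 0 + w0 - y1 \<noteq> \<beta> 2 + w2 - y0"
    "\<beta> 1 + w1 - y2 \<noteq> \<beta> 2 + w2 - y0"
    "\<alpha> 0 + x2 + x0 \<noteq> \<beta> 0 + y2 + y0" "\<alpha> 1 + x1 + x0 \<noteq> \<beta> 1 + y1 + y0"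
    "\<alpha> 2 + x1 + x2 \<noteq> \<beta> 2 + y1 + y2"
    using prism_weights[of "X 1" "X 2" "X 0" "Y 1" "Y 2" "Y 0" "W 0" "W 1" "W 2"
        "\<alpha> 0" "\<alpha> 1" "\<alpha> 2" "\<beta> 0" "\<beta> 1" "\<beta> 2"] card by auto
  define x y w where "x i = (if i = 0 then x0 else if i = 1 then x1 else x2)"
    and "y i = (if i = 0 then y0 else if i = 1 then y1 else y2)"
    and "w i = (if i = 0 then w0 else if i = 1 then w1 else w2)" for i :: nat
  have vals: "x 0 = x0" "x 1 = x1" "x 2 = x2" "y 0 = y0" "y 1 = y1" "y 2 = y2"
    "w 0 = w0" "w 1 = w1" "w 2 = w2" by (auto simp: x_def y_def w_def)
  have sums: "outer_sum 3 \<alpha> x w 0 = \<alpha> 0 + (x2 + x0) + w0"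
    "outer_sum 3 \<alpha> x w 1 = \<alpha> 1 + (x0 + x1) + w1"
    "outer_sum 3 \<alpha> x w 2 = \<alpha> 2 + (x1 + x2) + w2"
    "inner_sum 3 1 \<beta> y w 0 = \<beta> 0 + (y2 + y0) + w0"
    "inner_sum 3 1 \<beta> y w 1 = \<beta> 1 + (y0 + y1) + w1"
    "inner_sum 3 1 \<beta> y w 2 = \<beta> 2 + (y1 + y2) + w2"
    by (simp_all add: outer_sum_def inner_sum_def x_def y_def w_def)
  have m: "(0 + 1) mod 3 = (1::nat)" "(1 + 1) mod 3 = (2::nat)" "(2 + 1) mod 3 = (0::nat)"
    by auto
  show "\<exists>x y w. (\<forall>i<3. x i \<in> X i \<and> y i \<in> Y i \<and> w i \<in> W i) \<and>
       (2 * 1 = (3::nat) \<longrightarrow> (\<forall>i<3. y ((i + 1) mod 3) = y i)) \<and>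
       (\<forall>i<3. outer_sum 3 \<alpha> x w i \<noteq> outer_sum 3 \<alpha> x w ((i + 1) mod 3)) \<and>
       (\<forall>i<3. inner_sum 3 1 \<beta> y w i \<noteq> inner_sum 3 1 \<beta> y w ((i + 1) mod 3)) \<and>
       (\<forall>i<3. outer_sum 3 \<alpha> x w i \<noteq> inner_sum 3 1 \<beta> y w i)"
    unfolding all3 m
    by (rule exI[of _ x], rule exI[of _ y], rule exI[of _ w], unfold sums vals) (use neq mem in auto)
qed

section \<open>The case n >= 4 and 2t < n\<close>

lemma solvable_generic:
  assumes "n \<ge> 4" "1 \<le> t" "2 * t < n"
  shows "solvable n t"
  unfolding solvable_def
proof (intro allI impI)
  fix \<alpha> \<beta> :: "nat \<Rightarrow> real" and X Y W :: "nat \<Rightarrow> real set"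
  assume "(\<forall>i<n. card (X i) = 3 \<and> card (Y i) = 3 \<and> card (W i) = 3) \<and>
    (2 * t = n \<longrightarrow> (\<forall>i<n. Y ((i + t) mod n) = Y i))"
  then have X: "\<And>i. i < n \<Longrightarrow> card (X i) = 3" and Y: "\<And>i. i < n \<Longrightarrow> card (Y i) = 3"
    and W: "\<And>i. i < n \<Longrightarrow> card (W i) = 3"
    using assms by auto
  have n: "0 < n" "1 < n" "n - 1 < n" "n - 2 < n" "n - t < n" using assms by auto
  have card_uminus: "card (uminus ` A) = card A" for A :: "real set"
    by (rule card_image) auto
  \<comment> \<open>\<open>?D1\<close>, \<open>?D2\<close>, \<open>?D3\<close> belong to the edges
    \<open>u_(n-1) u_0\<close>, \<open>u_0 u_1\<close> and \<open>u_0 v_0\<close>. The last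
    constrains a sum of two outer weights, made a difference by negating \<open>X 0\<close>.\<close>
  let ?D1 = "repeated_diffs (X (n - 2)) (X 0)" and ?D2 = "repeated_diffs (X (n - 1)) (X 1)"
    and ?D3 = "repeated_diffs (X (n - 1)) (uminus ` X 0)"
  note D1 = card_repeated_diffs[OF X[OF n(4)] X[OF n(1)]]
  note D2 = card_repeated_diffs[OF X[OF n(3)] X[OF n(2)]]
  have "card (uminus ` X 0) = 3" using X[OF n(1)] card_uminus by simp
  note D3 = card_repeated_diffs[OF X[OF n(3)] this]
  \<comment> \<open>For all but at most one \<open>a\<close>, some weight of spoke
    \<open>n - 1\<close> leads outside \<open>?D1\<close>; likewise for spoke 1 and
    \<open>?D2\<close>. So one \<open>a\<close> suits both.\<close>
  have "\<exists>a\<in>W 0. \<not> (\<forall>c\<in>W (n - 1). (\<alpha> 0 + a - \<alpha> (n - 1)) + - c \<in> ?D1) \<and>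
      \<not> (\<forall>c\<in>W 1. (\<alpha> 1 - \<alpha> 0 - a) + c \<in> ?D2)"
  proof (rule card3_avoid[OF W[OF n(1)]])
    fix a b assume "\<forall>c\<in>W (n - 1). (\<alpha> 0 + a - \<alpha> (n - 1)) + - c \<in> ?D1"
      "\<forall>c\<in>W (n - 1). (\<alpha> 0 + b - \<alpha> (n - 1)) + - c \<in> ?D1"
    then have "\<alpha> 0 + a - \<alpha> (n - 1) = \<alpha> 0 + b - \<alpha> (n - 1)"
      by (intro translates_in_card3[OF _ D1, of "uminus ` W (n - 1)"])
        (use W[OF n(3)] card_uminus in auto)
    then show "a = b" by simp
  next
    fix a b assume "\<forall>c\<in>W 1. (\<alpha> 1 - \<alpha> 0 - a) + c \<in> ?D2" "\<forall>c\<in>W 1. (\<alpha> 1 - \<alpha> 0 - b) + c \<in> ?D2"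
    then have "\<alpha> 1 - \<alpha> 0 - a = \<alpha> 1 - \<alpha> 0 - b"
      by (intro translates_in_card3[OF W[OF n(2)] D2]) auto
    then show "a = b" by simp
  qed
  then obtain w0 w1 wm where w01m: "w0 \<in> W 0" "w1 \<in> W 1" "wm \<in> W (n - 1)"
    "\<alpha> 0 + w0 - \<alpha> (n - 1) - wm \<notin> ?D1" "\<alpha> 1 - \<alpha> 0 - w0 + w1 \<notin> ?D2" by auto
  obtain \<xi>1 where \<xi>1: "\<forall>a\<in>X (n - 2). \<forall>b\<in>X 0. b \<noteq> \<xi>1 \<longrightarrow> a - b \<noteq> \<alpha> 0 + w0 - \<alpha> (n - 1) - wm"
    using not_repeated_diff[OF w01m(4)] by auto
  obtain \<xi>2 where \<xi>2: "\<forall>a\<in>X (n - 1). \<forall>b\<in>X 1. b \<noteq> \<xi>2 \<longrightarrow> a - b \<noteq> \<alpha> 1 - \<alpha> 0 - w0 + w1"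
    using not_repeated_diff[OF w01m(5)] by auto
  \<comment> \<open>The same argument with one condition; \<open>False\<close> fills the second slot
    of \<open>card3_avoid\<close>.\<close>
  have "\<exists>a\<in>Y (n - t). \<not> (\<forall>c\<in>Y 0. (\<beta> 0 - \<alpha> 0 + a) + c \<in> ?D3) \<and> \<not> False"
  proof (rule card3_avoid[OF Y[OF n(5)]])
    fix a b assume "\<forall>c\<in>Y 0. (\<beta> 0 - \<alpha> 0 + a) + c \<in> ?D3" "\<forall>c\<in>Y 0. (\<beta> 0 - \<alpha> 0 + b) + c \<in> ?D3"
    then have "\<beta> 0 - \<alpha> 0 + a = \<beta> 0 - \<alpha> 0 + b"
      by (intro translates_in_card3[OF Y[OF n(1)] D3]) auto
    then show "a = b" by simp
  qed auto
  then obtain ym y0 where y0m: "ym \<in> Y (n - t)" "y0 \<in> Y 0" "\<beta> 0 - \<alpha> 0 + ym + y0 \<notin> ?D3" by auto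
  obtain \<xi> where "\<forall>a\<in>X (n - 1). \<forall>b\<in>uminus ` X 0. b \<noteq> \<xi> \<longrightarrow> a - b \<noteq> \<beta> 0 - \<alpha> 0 + ym + y0"
    using not_repeated_diff[OF y0m(3)] by auto
  then have \<xi>: "\<forall>a\<in>X (n - 1). \<forall>b\<in>X 0. b \<noteq> - \<xi> \<longrightarrow> a + b \<noteq> \<beta> 0 - \<alpha> 0 + ym + y0"
    by auto
  have "\<forall>i<n. \<exists>v. v \<in> W i"
    using W by (metis card.empty ex_in_conv zero_neq_numeral)
  then obtain wb where wb: "\<And>i. i < n \<Longrightarrow> wb i \<in> W i" by metis
  have "\<exists>w. (\<forall>i<n. w i \<in> W i) \<and> w 0 = w0 \<and> w 1 = w1 \<and> w (n - 1) = wm \<and>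
    (n = 3 * t \<longrightarrow> \<beta> t + y0 + w t \<noteq> \<beta> (2 * t) + ym + w (2 * t))"
  proof -
    \<comment> \<open>For \<open>n = 3t\<close> the two inner edges chosen in advance share the inner edge \<open>v\<^sub>tv\<^sub>2\<^sub>t\<close>
      as a constraint.\<close>
    define w where "w = wb(0 := w0, 1 := w1, n - 1 := wm)"
    have w: "\<forall>i<n. w i \<in> W i" "w 0 = w0" "w 1 = w1" "w (n - 1) = wm"
      using wb w01m assms(1) by (auto simp: w_def)
    have "t < n" using assms by simp
    obtain v where v: "v \<in> W t" "v \<noteq> \<beta> (2 * t) + ym + w (2 * t) - \<beta> t - y0"
      using card3_avoid_values[OF W[OF \<open>t < n\<close>]] by blast
    show ?thesis
    proof (cases "n = 3 * t")
      case True
      \<comment> \<open>From \<open>n \<ge> 4\<close> follows \<open>t \<ge> 2\<close>, so spoke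
        \<open>t\<close> is not among those fixed in advance and may be changed to
        \<open>v\<close>.\<close>
      then have "t \<noteq> 0" "t \<noteq> 1" "t \<noteq> n - 1" using assms by auto
      then show ?thesis using w v by (intro exI[of _ "w(t := v)"]) auto
    qed (use w in blast)
  qed
  then obtain w where w: "\<And>i. i < n \<Longrightarrow> w i \<in> W i" "w 0 = w0" "w 1 = w1" "w (n - 1) = wm"
    "n = 3 * t \<longrightarrow> \<beta> t + y0 + w t \<noteq> \<beta> (2 * t) + ym + w (2 * t)" by blast
  obtain y where y: "\<And>i. i \<in> {..<n} - {0, n - t} \<Longrightarrow> y i \<in> Y i"
    "\<And>i. i \<notin> {..<n} - {0, n - t} \<Longrightarrow> y i = (if i = 0 then y0 else ym)"
    and y_next: "\<And>i. i < n \<Longrightarrow>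
      (i + (n - t)) mod n \<in> {..<n} - {0, n - t} \<or> (i + t) mod n \<in> {..<n} - {0, n - t} \<Longrightarrow>
      \<beta> i + y ((i + (n - t)) mod n) + w i \<noteq>
      \<beta> ((i + t) mod n) + y ((i + t) mod n) + w ((i + t) mod n)"
    by (rule greedy_on_ring[of t n "{..<n} - {0, n - t}" Y "\<lambda>i. if i = 0 then y0 else ym" \<beta> w])
      (use Y assms in auto)
  have y_vals: "y 0 = y0" "y (n - t) = ym" using y(2)[of 0] y(2)[of "n - t"] n assms by auto
  have y_mem: "y i \<in> Y i" if "i < n" for i
    using y(1)[of i] that y_vals y0m by (cases "i = 0 \<or> i = n - t") auto
  have inner: "\<beta> i + y ((i + (n - t)) mod n) + w i \<noteq>
      \<beta> ((i + t) mod n) + y ((i + t) mod n) + w ((i + t) mod n)" if i: "i < n" for i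
  proof (cases "(i + (n - t)) mod n \<in> {..<n} - {0, n - t} \<or> (i + t) mod n \<in> {..<n} - {0, n - t}")
    case False
    moreover have mods: "(i + (n - t)) mod n = (if i < t then i + n - t else i - t)"
      "(i + t) mod n = (if i + t < n then i + t else i + t - n)"
      unfolding mod_add_cases[OF i diff_le_self] using i assms by (auto simp: mod_add_cases)
    \<comment> \<open>The indices \<open>i - t\<close> and \<open>i + t\<close> are both fixed only
      if they are 0 and \<open>n - t\<close> in this order; the choice of \<open>w t\<close> covers
      this case.\<close>
    ultimately have it: "i = t" "n = 3 * t"
      using i assms unfolding mods by (auto split: if_splits)
    have "(t + (n - t)) mod n = 0" "(t + t) mod n = 2 * t" "n - t = 2 * t"
      using it assms by auto
    then show ?thesis using w(5) y_vals it by auto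
  qed (use y_next i in blast)
  \<comment> \<open>The spoke at \<open>i\<close> fails when \<open>x (i - 1) + x i = e i\<close>,
    and the outer edge from \<open>i - 1\<close> to \<open>i\<close> fails when
    \<open>x i - x (i - 2) = g i\<close>.\<close>
  define e where "e i = \<beta> i + y ((i + (n - t)) mod n) + y i - \<alpha> i" for i
  define g where "g i = \<alpha> (i - 1) + w (i - 1) - \<alpha> i - w i" for i
  \<comment> \<open>\<open>P f i r\<close> allows \<open>r\<close> as the value at \<open>i\<close>,
    given \<open>f\<close> below \<open>i\<close>. It holds trivially for \<open>i \<ge> n\<close>,
    so that the recursion runs over all naturals.\<close>
  define P where "P f i r \<longleftrightarrow> (i < n \<longrightarrow> r \<in> X i \<and> (i = 0 \<longrightarrow> r \<noteq> \<xi>1 \<and> r \<noteq> - \<xi>) \<and>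
     (i = 1 \<longrightarrow> r \<noteq> \<xi>2) \<and> (i \<ge> 1 \<longrightarrow> r \<noteq> e i - f (i - 1)) \<and> (i \<ge> 2 \<longrightarrow> r \<noteq> f (i - 2) + g i))"
    for f :: "nat \<Rightarrow> real" and i r
  have "\<exists>x. \<forall>i. P x i (x i)"
  proof (rule dependent_wellorder_choice)
    fix r :: real and f f' :: "nat \<Rightarrow> real" and i :: nat
    assume "\<And>j. j < i \<Longrightarrow> f j = f' j"
    then show "P f i r = P f' i r" by (auto simp: P_def)
  next
    fix i :: nat and f :: "nat \<Rightarrow> real"
    show "\<exists>r. P f i r"
    proof (cases "i < n")
      case True
      have *: "\<exists>r\<in>X i. r \<noteq> u \<and> r \<noteq> v" for u v
        using card3_avoid_values[OF X[OF True]] by blast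
      \<comment> \<open>From index 2 on, the spoke and the outer edge use up both exclusions. Index
        0 has two to spare, for \<open>\<xi>1\<close> and \<open>- \<xi>\<close>, and index 1 has
        one, for \<open>\<xi>2\<close>.\<close>
      consider "i = 0" | "i = 1" | "i \<ge> 2" by linarith
      then show ?thesis
      proof cases
        case 1
        then show ?thesis using *[of \<xi>1 "- \<xi>"] by (auto simp: P_def)
      next
        case 2
        then show ?thesis using *[of \<xi>2 "e i - f (i - 1)"] by (auto simp: P_def)
      next
        case 3
        then show ?thesis using *[of "f (i - 2) + g i" "e i - f (i - 1)"] by (auto simp: P_def)
      qed
    qed (simp add: P_def)
  qed
  then obtain x where x: "\<And>i. P x i (x i)" by blast
  have x_mem: "x i \<in> X i" if "i < n" for i using x[of i] that by (simp add: P_def)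
  have outer: "\<alpha> i + x ((i + (n - 1)) mod n) + w i \<noteq>
      \<alpha> ((i + 1) mod n) + x ((i + 1) mod n) + w ((i + 1) mod n)" if i: "i < n" for i
  proof -
    consider "i = 0" | "i = n - 1" | "1 \<le> i" "i < n - 1" using i by linarith
    then show ?thesis
    proof cases
      case 1
      have "x (n - 1) - x 1 \<noteq> \<alpha> 1 - \<alpha> 0 - w0 + w1"
        using \<xi>2 x[of 1] x_mem n by (auto simp: P_def)
      then show ?thesis using 1 n w by auto
    next
      case 2
      have "x (n - 2) - x 0 \<noteq> \<alpha> 0 + w0 - \<alpha> (n - 1) - wm"
        using \<xi>1 x[of 0] x_mem n by (auto simp: P_def)
      moreover have "(i + (n - 1)) mod n = n - 2" "(i + 1) mod n = 0"
        unfolding mod_add_cases[OF i diff_le_self] using 2 assms by auto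
      ultimately show ?thesis using 2 w by auto
    next
      case 3
      have "x (i + 1) \<noteq> x (i - 1) + g (i + 1)"
        using x[of "i + 1"] 3 by (auto simp: P_def)
      moreover have "(i + (n - 1)) mod n = i - 1" "(i + 1) mod n = i + 1"
        unfolding mod_add_cases[OF i diff_le_self] using 3 by auto
      ultimately show ?thesis by (auto simp: g_def)
    qed
  qed
  have spoke: "\<alpha> i + x ((i + (n - 1)) mod n) + x i \<noteq> \<beta> i + y ((i + (n - t)) mod n) + y i"
    if i: "i < n" for i
  proof (cases "i = 0")
    case True
    have "x (n - 1) + x 0 \<noteq> \<beta> 0 - \<alpha> 0 + ym + y0"
      using \<xi> x[of 0] x_mem n by (auto simp: P_def)
    then show ?thesis using True n y_vals by auto
  next
    case False
    then have "x i \<noteq> e i - x (i - 1)" using x[of i] i by (auto simp: P_def)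
    moreover have "(i + (n - 1)) mod n = i - 1"
      unfolding mod_add_cases[OF i diff_le_self] using False i by auto
    ultimately show ?thesis by (auto simp: e_def)
  qed
  have t: "(2 * t = n) = False" using assms by simp
  show "\<exists>x y w. (\<forall>i<n. x i \<in> X i \<and> y i \<in> Y i \<and> w i \<in> W i) \<and>
       (2 * t = n \<longrightarrow> (\<forall>i<n. y ((i + t) mod n) = y i)) \<and>
       (\<forall>i<n. outer_sum n \<alpha> x w i \<noteq> outer_sum n \<alpha> x w ((i + 1) mod n)) \<and>
       (\<forall>i<n. inner_sum n t \<beta> y w i \<noteq> inner_sum n t \<beta> y w ((i + t) mod n)) \<and>
       (\<forall>i<n. outer_sum n \<alpha> x w i \<noteq> inner_sum n t \<beta> y w i)"
  proof (rule exI[of _ x], rule exI[of _ y], rule exI[of _ w], intro conjI allI impI)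
    fix i assume i: "i < n"
    show "outer_sum n \<alpha> x w i \<noteq> outer_sum n \<alpha> x w ((i + 1) mod n)"
      using i n outer by (intro outer_sum_neq_next) auto
    show "inner_sum n t \<beta> y w i \<noteq> inner_sum n t \<beta> y w ((i + t) mod n)"
      using i assms(3) inner by (intro inner_sum_neq_next) auto
    show "outer_sum n \<alpha> x w i \<noteq> inner_sum n t \<beta> y w i"
      using spoke[OF i] unfolding outer_sum_def inner_sum_def t if_False by argo
  qed (use x_mem y_mem w t in auto)
qed

theorem theorem3p2:
  fixes n t :: nat
  assumes "n \<ge> 3" and "1 \<le> t" and "real t \<le> real n / 2"
  shows "choosable 1 3 (petersen n t)"
proof -
  have le: "2 * t \<le> n" using assms(3) by linarith
  consider "n = 2 * t" | "n = 3" "t = 1" | "n \<ge> 4" "2 * t < n"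
    using assms(1,2) le by linarith
  then have "solvable n t"
    using solvable_half solvable_prism solvable_generic assms by cases auto
  then show ?thesis using choosable_if_solvable assms le by blast
qed

end
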